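(* Let $v$, $k$ and $\lambda$ be positive integers such that $3 \leq k < v$, let $r$ and $d$ be the integers such that $\lambda(v-1)=r(k-1)+d$ and $0 \leq d < k-1$, let $n=r-\lambda$, and suppose that $r<k$. If $d < n$, then (a) $D_\lambda(v,k) \leq \left\lfloor DB_{(v,k,\lambda)}\left(1-\frac{d^2}{2n(n-1)},\frac{n}{2(d+k)}\right)\right\rfloor$; (b) $D_\lambda(v,k) \leq \left\lfloor DB_{(v,k,\lambda)}\left(1,1-\frac{d(d+k-1)}{n(n-1)}\right)\right\rfloor$ if $d \geq \frac{n}{2}$ and $d(d+k-1) < n(n-1)$; and (c) $D_\lambda(v,k) \leq \left\lfloor DB_{(v,k,\lambda)}\left(1,\sqrt{\frac{dn}{(n-1)(n-d)}}-\frac{d(d+k)}{2(n-1)(n-d)}\right)\right\rfloor$ if $d < \frac{n}{2}$ and $4n(n-1)(n-d) > d(d+k)^2$.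
   Context: A $(v,k,\lambda)$-packing is a pair $(V,\mathcal{B})$ where $V$ is a set of $v$ points and $\mathcal{B}$ is a collection of $k$-subsets of $V$ (blocks) such that every pair of distinct points lies together in at most $\lambda$ blocks; $D_\lambda(v,k)$ is the maximum number of blocks in a $(v,k,\lambda)$-packing. For positive integers $v,k,\lambda$ with $3\le k<v$ and nonnegative reals $\alpha\ge\beta$ with $\alpha>\beta+\frac1k$, define $$DB_{(v,k,\lambda)}(\alpha,\beta)=\frac{rv(\alpha-\beta)-\alpha v}{k(\alpha-\beta)-1},\qquad r=\left\lfloor\frac{\lambda(v-1)}{k-1}\right\rfloor.$$ *)

theory Defs
  imports Complex_Main "HOL-Library.Multiset"
begin

text \<open>The blocks form a multiset: as usual for packings with index \<open>\<lambda> > 1\<close>, repeated blocks are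
  allowed and a pair's cover count respects multiplicity.\<close>

definition packing :: "nat \<Rightarrow> nat \<Rightarrow> nat \<Rightarrow> 'a set \<Rightarrow> 'a set multiset \<Rightarrow> bool" where
  "packing v k l V \<B> \<longleftrightarrow>
     finite V \<and> card V = v \<and>
     (\<forall>b \<in># \<B>. b \<subseteq> V \<and> card b = k) \<and>
     (\<forall>x \<in> V. \<forall>y \<in> V. x \<noteq> y \<longrightarrow> size {# b \<in># \<B>. x \<in> b \<and> y \<in> b #} \<le> l)"

text \<open>The maximum exists and is attained for \<open>2 \<le> k\<close>, and the choice of \<open>nat\<close> as the type of points is
  immaterial; see \<open>packing_number_attained\<close> and \<open>packing_size_le_packing_number\<close>.\<close>

definition packing_number :: "nat \<Rightarrow> nat \<Rightarrow> nat \<Rightarrow> nat" where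
  "packing_number l v k = Max {size \<B> | (V :: nat set) \<B>. packing v k l V \<B>}"

definition DB :: "nat \<Rightarrow> nat \<Rightarrow> nat \<Rightarrow> real \<Rightarrow> real \<Rightarrow> real" where
  "DB v k l \<alpha> \<beta> =
     (let r = real_of_int \<lfloor>real l * (real v - 1) / (real k - 1)\<rfloor>
      in (r * real v * (\<alpha> - \<beta>) - \<alpha> * real v) / (real k * (\<alpha> - \<beta>) - 1))"

lemma size_filter_sum_mset:
  "size {# b \<in># \<B>. P b #} = (\<Sum>b\<in>#\<B>. if P b then 1 else (0::nat))"
  by (induction \<B>) auto

lemma packing_size_bound:
  assumes p: "packing v k l V \<B>" and k: "2 \<le> k"
  shows "size \<B> \<le> l * (v * v)"
proof -
  define S where "S = {p \<in> V \<times> V. fst p \<noteq> snd p}"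
  have fV: "finite V" and cV: "card V = v" using p by (auto simp: packing_def)
  have fS: "finite S" using fV by (auto simp: S_def)
  have cS: "card S \<le> v * v"
    using card_mono[of "V \<times> V" S] fV cV by (auto simp: S_def card_cartesian_product)
  have one: "1 \<le> (\<Sum>p\<in>S. if fst p \<in> b \<and> snd p \<in> b then 1 else (0::nat))"
    if b: "b \<in># \<B>" for b
  proof -
    have "b \<subseteq> V" "card b = k" using p b by (auto simp: packing_def)
    then obtain x y where xy: "x \<in> b" "y \<in> b" "x \<noteq> y"
      using k by (metis card_le_Suc0_iff_eq card.infinite not_less_eq_eq numeral_2_eq_2 zero_less_Suc leD order_trans)
    have "(x, y) \<in> S" using xy \<open>b \<subseteq> V\<close> by (auto simp: S_def)
    then have "(\<Sum>p\<in>{(x,y)}. if fst p \<in> b \<and> snd p \<in> b then 1 else (0::nat))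
       \<le> (\<Sum>p\<in>S. if fst p \<in> b \<and> snd p \<in> b then 1 else (0::nat))"
      using fS by (intro sum_mono2) auto
    then show ?thesis using xy by simp
  qed
  have "size \<B> = (\<Sum>b\<in>#\<B>. 1)" by simp
  also have "\<dots> \<le> (\<Sum>b\<in>#\<B>. \<Sum>p\<in>S. if fst p \<in> b \<and> snd p \<in> b then 1 else (0::nat))"
    by (intro sum_mset_mono) (use one in auto)
  also have "\<dots> = (\<Sum>p\<in>S. \<Sum>b\<in>#\<B>. if fst p \<in> b \<and> snd p \<in> b then 1 else (0::nat))"
    by (induction \<B>) (auto simp: sum.distrib)
  also have "\<dots> = (\<Sum>p\<in>S. size {# b \<in># \<B>. fst p \<in> b \<and> snd p \<in> b #})"
    by (simp add: size_filter_sum_mset)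
  also have "\<dots> \<le> (\<Sum>p\<in>S. l)"
    by (intro sum_mono) (use p in \<open>auto simp: packing_def S_def\<close>)
  also have "\<dots> \<le> l * (v * v)" using cS by simp
  finally show ?thesis .
qed

lemma finite_packing_sizes:
  assumes "2 \<le> k"
  shows "finite {size \<B> | V \<B>. packing v k l V \<B>}"
  by (rule finite_subset[of _ "{..l * (v * v)}"]) (use packing_size_bound[OF _ assms] in auto)

lemma packing_number_attained:
  assumes "2 \<le> k"
  shows "\<exists>(V :: nat set) \<B>. packing v k l V \<B> \<and> size \<B> = packing_number l v k"
proof -
  let ?X = "{size \<B> | (V :: nat set) \<B>. packing v k l V \<B>}"
  have "packing v k l {..<v} {#}" by (simp add: packing_def)
  then have "size ({#} :: nat set multiset) \<in> ?X" by blast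
  then have "Max ?X \<in> ?X" using finite_packing_sizes[OF assms] by (intro Max_in) auto
  then show ?thesis unfolding packing_number_def[symmetric] by force
qed

lemma packing_size_le_packing_number:
  fixes V :: "'a set"
  assumes p: "packing v k l V \<B>" and k: "2 \<le> k"
  shows "size \<B> \<le> packing_number l v k"
proof -
  have fV: "finite V" and cV: "card V = v" using p by (auto simp: packing_def)
  obtain f :: "'a \<Rightarrow> nat" where inj: "inj_on f V"
    using finite_imp_inj_to_nat_seg[OF fV] by auto
  have sub: "b \<subseteq> V" if "b \<in># \<B>" for b using p that by (auto simp: packing_def)
  have mem: "f x \<in> f ` b \<longleftrightarrow> x \<in> b" if "b \<in># \<B>" "x \<in> V" for b x
    using sub[OF that(1)] that(2) inj by (auto simp: inj_on_def)
  have "packing v k l (f ` V) (image_mset ((`) f) \<B>)"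
    unfolding packing_def
  proof (intro conjI ballI impI)
    show "finite (f ` V)" using fV by simp
    show "card (f ` V) = v" using inj cV by (simp add: card_image)
  next
    fix c assume "c \<in># image_mset ((`) f) \<B>"
    then obtain b where b: "b \<in># \<B>" "c = f ` b" by auto
    show "c \<subseteq> f ` V" using b sub by auto
    have "card b = k" using p b by (auto simp: packing_def)
    then show "card c = k" using b inj_on_subset[OF inj sub[OF b(1)]] by (simp add: card_image)
  next
    fix x' y' assume "x' \<in> f ` V" "y' \<in> f ` V" "x' \<noteq> y'"
    then obtain x y where xy: "x \<in> V" "y \<in> V" "x \<noteq> y" "x' = f x" "y' = f y" by auto
    have "{# c \<in># image_mset ((`) f) \<B>. x' \<in> c \<and> y' \<in> c #}
        = image_mset ((`) f) {# b \<in># \<B>. f x \<in> f ` b \<and> f y \<in> f ` b #}"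
      by (simp add: filter_mset_image_mset xy)
    also have "{# b \<in># \<B>. f x \<in> f ` b \<and> f y \<in> f ` b #} = {# b \<in># \<B>. x \<in> b \<and> y \<in> b #}"
      by (rule filter_mset_cong) (use mem xy in auto)
    finally show "size {# c \<in># image_mset ((`) f) \<B>. x' \<in> c \<and> y' \<in> c #} \<le> l"
      using p xy by (auto simp: packing_def)
  qed
  then have "size (image_mset ((`) f) \<B>) \<in> {size \<B> | (V :: nat set) \<B>. packing v k l V \<B>}"
    by blast
  then show ?thesis
    unfolding packing_number_def using finite_packing_sizes[OF k] by (auto intro: Max_ge)
qed

end

theory Submission
  imports Defs
begin

text \<open>If the Gram matrix of the rows (indexed by blocks) of a set of points is positive definite, there are
  at least as many blocks as points in the set. Call a point full if it lies on \<open>r\<close> blocks and deficient if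
  it lies on \<open>r - 1\<close>; their degrees in the leave multigraph are \<open>d\<close> and \<open>d + k - 1\<close>. Rescaling the full
  against the deficient points so that a full point is just diagonally dominant, an edge of the leave
  between a full and a deficient point burdens the deficient point only with weight \<open>\<theta> = d / n\<close>. So all
  full points together with a set \<open>S\<close> of deficient points are independent as soon as
  every weighted degree within the set is below \<open>n - 1\<close> on \<open>S\<close>. Repeatedly deleting a deficient point of
  largest weighted degree, as in the theorem of Caro and Tuza, yields a large \<open>S\<close>. The lower bound on its size
  charges each full-deficient edge an extra \<open>\<theta> / (2 (n - 1))\<close>: charging this to the full end gives (a), and
  charging it to the deficient end gives (b) and (c). Double counting flags turns
  \<open>size \<B> \<ge> \<alpha> (number of full points) + \<beta> (number of deficient points)\<close> into the bound \<open>DB\<close>.\<close>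

section \<open>Sparse sets in weighted multigraphs\<close>

text \<open>For a positive integer \<open>m\<close> this is the Caro-Tuza function of the degree:
  summed over the vertices of a graph, it bounds from below the size of a largest vertex set
  inducing maximum degree below \<open>m\<close>. The branches meet at \<open>m\<close> with value
  \<open>1 / 2\<close>.\<close>

definition caro_tuza :: "real \<Rightarrow> real \<Rightarrow> real" where
  "caro_tuza m x = (if x \<le> m then 1 - x / (2 * m) else (m + 1) / (2 * (x + 1)))"

lemma caro_tuza_le_one: "0 < m \<Longrightarrow> 0 \<le> x \<Longrightarrow> caro_tuza m x \<le> 1"
  by (auto simp: caro_tuza_def divide_simps)

lemma caro_tuza_ge: "0 < m \<Longrightarrow> m \<le> x \<Longrightarrow> caro_tuza m x = (m + 1) / (2 * (x + 1))"
  by (auto simp: caro_tuza_def divide_simps)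

lemma caro_tuza_ge_linear:
  assumes "0 < m"
  shows "1 - x / (2 * m) \<le> caro_tuza m x"
proof (cases "x \<le> m")
  case False
  have "(2 * m - x) * (x + 1) - (m + 1) * m = (x - m) * (m - 1 - x)"
    by (simp add: algebra_simps)
  also have "\<dots> \<le> 0" using False by (intro mult_nonneg_nonpos) auto
  finally have "(2 * m - x) * (x + 1) \<le> (m + 1) * m" by simp
  then show ?thesis using False assms by (simp add: caro_tuza_def field_simps)
qed (simp add: caro_tuza_def)

text \<open>The gain is the drop of the hyperbola \<open>(m + 1) / (2 * (t + 1))\<close> from
  \<open>t = D - 1\<close> to \<open>t = D\<close>. Both branches are at least as steep further
  left, so a unit step ending at \<open>x \<le> D\<close> gains no less.\<close>

lemma caro_tuza_step:
  assumes m: "0 < m" and "m \<le> D" "x \<le> D"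
  shows "(m + 1) / (2 * D * (D + 1)) + caro_tuza m x \<le> caro_tuza m (x - 1)"
proof (cases "x \<le> m")
  case True
  have "(m + 1) / (2 * D * (D + 1)) \<le> (m + 1) / (2 * m * (m + 1))"
    using assms by (intro divide_left_mono mult_mono mult_pos_pos) auto
  also have "\<dots> = 1 / (2 * m)" using m by simp
  finally show ?thesis using True by (simp add: caro_tuza_def diff_divide_distrib)
next
  case False
  have "(m + 1) / (2 * D * (D + 1)) \<le> (m + 1) / (2 * x * (x + 1))"
    using assms False by (intro divide_left_mono mult_mono mult_pos_pos) auto
  moreover have "(m + 1) / (2 * x * (x + 1)) + (m + 1) / (2 * (x + 1)) = (m + 1) / (2 * x)"
    using m False by (simp add: divide_simps) (simp add: algebra_simps)
  \<comment> \<open>The left side is the hyperbola at \<open>x - 1\<close>. If the step straddles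
    \<open>m\<close>, the linear branch lies above it because
    \<open>0 \<le> x - m \<le> 1\<close>.\<close>
  moreover have "(m + 1) / (2 * x) \<le> caro_tuza m (x - 1)"
  proof (cases "x - 1 \<le> m")
    case True
    have "(x - m) * (x - m - 1) \<le> 0"
      using True False by (intro mult_nonneg_nonpos) auto
    then have "(m + 1) * m \<le> (2 * m - (x - 1)) * x" by (simp add: algebra_simps)
    then show ?thesis using True m False by (simp add: caro_tuza_def field_simps)
  qed (simp add: caro_tuza_def)
  ultimately show ?thesis using False by (simp add: caro_tuza_def)
qed

text \<open>Iterated unit steps, for a vertex that loses \<open>j\<close> parallel edges at once.
  The same \<open>D\<close> serves throughout since the argument only decreases.\<close>

lemma caro_tuza_steps:
  assumes "0 < m" "m \<le> D" "x \<le> D"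
  shows "real j * ((m + 1) / (2 * D * (D + 1))) + caro_tuza m x \<le> caro_tuza m (x - real j)"
proof (induction j)
  case (Suc j)
  define g where "g = (m + 1) / (2 * D * (D + 1))"
  define F where "F = (\<lambda>j. caro_tuza m (x - real j))"
  have "g + caro_tuza m (x - real j) \<le> caro_tuza m (x - real j - 1)"
    unfolding g_def using assms by (intro caro_tuza_step) auto
  then have "g + F j \<le> F (Suc j)" by (simp add: F_def diff_diff_eq add.commute)
  moreover have "real (Suc j) * g = real j * g + g" by (simp add: algebra_simps)
  moreover have "real j * g + F 0 \<le> F j" using Suc by (simp add: F_def g_def)
  ultimately have "real (Suc j) * g + F 0 \<le> F (Suc j)" by linarith
  then show ?case by (simp only: F_def g_def of_nat_0 diff_zero)
qed simp

lemma caro_tuza_antimono: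
  assumes m: "0 < m" and xy: "x \<le> y"
  shows "caro_tuza m y \<le> caro_tuza m x"
proof -
  consider "y \<le> m" | "x \<le> m" "m < y" | "m < x" using xy by linarith
  then show ?thesis
  proof cases
    case 1 then show ?thesis using m xy by (simp add: caro_tuza_def divide_right_mono)
  next
    case 2
    have "(m + 1) / (2 * (y + 1)) \<le> 1 / 2" using 2 m by (simp add: divide_simps)
    moreover have "1 / 2 \<le> 1 - x / (2 * m)" using 2 m by (simp add: divide_simps)
    ultimately have "(m + 1) / (2 * (y + 1)) \<le> 1 - x / (2 * m)" by (rule order_trans)
    then show ?thesis using 2 by (simp add: caro_tuza_def)
  next
    case 3 then show ?thesis using m xy by (simp add: caro_tuza_def frac_le)
  qed
qed

text \<open>Only the multiplicities \<open>mu\<close> are integral, so that the convexity of \<open>caro_tuza m\<close> at unit steps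
  pays for the deletion of a vertex. The possibly fractional weight \<open>w x\<close> towards vertices that are never
  deleted is what the extra term \<open>w x / (2 * m)\<close> compensates.\<close>

lemma caro_tuza_weighted:
  fixes mu :: "'a \<Rightarrow> 'a \<Rightarrow> nat" and w :: "'a \<Rightarrow> real"
  assumes "finite T" and m: "0 < m"
    and sym: "\<And>x y. mu x y = mu y x" and irr: "\<And>x. mu x x = 0" and w: "\<And>x. 0 \<le> w x"
  shows "\<exists>S \<subseteq> T. (\<forall>x\<in>S. (\<Sum>y\<in>S. real (mu x y)) + w x < m) \<and>
           (\<Sum>x\<in>T. caro_tuza m ((\<Sum>y\<in>T. real (mu x y)) + w x) - w x / (2 * m)) \<le> real (card S)"
  using \<open>finite T\<close>
proof (induction rule: finite_psubset_induct)
  case (psubset T)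
  define deg where "deg = (\<lambda>T x. (\<Sum>y\<in>T. real (mu x y)) + w x)"
  have deg0: "0 \<le> deg T x" for T x
    unfolding deg_def using w by (intro add_nonneg_nonneg sum_nonneg) auto
  show ?case
  proof (cases "\<forall>x\<in>T. deg T x < m")
    case True
    \<comment> \<open>Nothing has to be deleted, and each summand is at most 1.\<close>
    have "(\<Sum>x\<in>T. caro_tuza m (deg T x) - w x / (2 * m)) \<le> (\<Sum>x\<in>T. 1)"
    proof (intro sum_mono)
      fix x
      have "0 \<le> w x / (2 * m)" using w m by simp
      then show "caro_tuza m (deg T x) - w x / (2 * m) \<le> 1"
        using caro_tuza_le_one[OF m deg0[of T x]] by linarith
    qed
    then show ?thesis using True by (intro exI[of _ T]) (auto simp: deg_def)
  next
    case False
    then have "T \<noteq> {}" by auto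
    define D where "D = Max (deg T ` T)"
    have "D \<in> deg T ` T" unfolding D_def using \<open>T \<noteq> {}\<close> psubset.hyps by (intro Max_in) auto
    then obtain x where x: "x \<in> T" "deg T x = D" by auto
    have le_D: "deg T y \<le> D" if "y \<in> T" for y
      unfolding D_def using psubset.hyps that by auto
    obtain y where "y \<in> T" "m \<le> deg T y" using False by force
    then have mD: "m \<le> D" using le_D[of y] by simp
    \<comment> \<open>The gain guaranteed to a remaining vertex for each edge to the deleted vertex
      \<open>x\<close>.\<close>
    define g where "g = (m + 1) / (2 * D * (D + 1))"
    define U where "U = T - {x}"
    have T: "T = insert x U" "x \<notin> U" "finite U" using x psubset.hyps by (auto simp: U_def)
    have "U \<subset> T" using x by (auto simp: U_def)
    from psubset.IH[OF this] obtain S where S: "S \<subseteq> U" "\<forall>x\<in>S. deg S x < m"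
      "(\<Sum>x\<in>U. caro_tuza m (deg U x) - w x / (2 * m)) \<le> real (card S)"
      unfolding deg_def by (elim exE conjE)
    have gain: "real (mu x y) * g + caro_tuza m (deg T y) \<le> caro_tuza m (deg U y)" if "y \<in> U" for y
    proof -
      have "deg U y = deg T y - real (mu x y)" using T sym[of x y] by (simp add: deg_def)
      then show ?thesis using caro_tuza_steps[OF m mD le_D[of y]] that T by (simp add: g_def)
    qed
    \<comment> \<open>The loss caused by deleting \<open>x\<close>. On the hyperbola
      \<open>caro_tuza m D = D * g\<close>, and the discount \<open>w x / (2 * m)\<close> covers
      \<open>w x * g\<close> because \<open>m \<le> D\<close>. What remains is \<open>g\<close> for
      each edge from \<open>x\<close> into \<open>U\<close>, which the neighbours gain back.\<close>
    have "caro_tuza m D - w x / (2 * m) \<le> (D - w x) * g"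
    proof -
      have "g \<le> (m + 1) / (2 * m * (m + 1))"
        unfolding g_def using m mD by (intro divide_left_mono mult_mono mult_pos_pos) auto
      also have "\<dots> = 1 / (2 * m)" using m by simp
      finally have "w x * g \<le> w x * (1 / (2 * m))" using w by (intro mult_left_mono) auto
      moreover have "caro_tuza m D = D * g"
        using m mD by (simp add: caro_tuza_ge g_def)
      ultimately show ?thesis by (simp add: algebra_simps)
    qed
    also have "D - w x = (\<Sum>y\<in>U. real (mu x y))" using x T irr by (simp add: deg_def)
    also have "\<dots> * g = (\<Sum>y\<in>U. real (mu x y) * g)" by (simp add: sum_distrib_right)
    also have "\<dots> \<le> (\<Sum>y\<in>U. caro_tuza m (deg U y) - caro_tuza m (deg T y))"
      using gain by (intro sum_mono) (simp add: algebra_simps)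
    finally have "(\<Sum>x\<in>T. caro_tuza m (deg T x) - w x / (2 * m))
        \<le> (\<Sum>x\<in>U. caro_tuza m (deg U x) - w x / (2 * m))"
      using T x by (simp add: sum_subtractf)
    with S have "(\<Sum>x\<in>T. caro_tuza m (deg T x) - w x / (2 * m)) \<le> real (card S)" by linarith
    moreover have "S \<subseteq> T" using S T by auto
    ultimately show ?thesis using S(2) unfolding deg_def by (intro exI[of _ S] conjI)
  qed
qed

section \<open>Linear independence of point rows\<close>

text \<open>Gaussian elimination: a pivot \<open>p\<close> of the first equation is eliminated from
  the others, which leaves one unknown and one equation fewer.\<close>

lemma nontrivial_solution:
  fixes fs :: "('a \<Rightarrow> real) list"
  assumes "finite W" and "length fs < card W"
  shows "\<exists>z. (\<exists>x\<in>W. z x \<noteq> 0) \<and> (\<forall>f\<in>set fs. (\<Sum>x\<in>W. f x * z x) = 0)"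
  using assms
proof (induction "length fs" arbitrary: fs W)
  case 0
  then obtain x where "x \<in> W" by fastforce
  then show ?case using 0 by (intro exI[of _ "\<lambda>_. 1"]) auto
next
  case (Suc b)
  then obtain g gs where fs: "fs = g # gs" "b = length gs" by (cases fs) auto
  show ?case
  proof (cases "\<forall>x\<in>W. g x = 0")
    case True
    then have "(\<Sum>x\<in>W. g x * z x) = 0" for z by simp
    then show ?thesis using Suc.hyps(1)[of gs W] Suc.prems fs by auto
  next
    case False
    then obtain p where p: "p \<in> W" "g p \<noteq> 0" by auto
    define U where "U = W - {p}"
    have W: "W = insert p U" "p \<notin> U" "finite U" using p Suc.prems by (auto simp: U_def)
    define elim where "elim = (\<lambda>f x. f x - f p * g x / g p)"
    obtain z where z: "\<exists>x\<in>U. z x \<noteq> 0" "\<forall>f\<in>set (map elim gs). (\<Sum>x\<in>U. f x * z x) = 0"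
      using Suc.hyps(1)[of "map elim gs" U] W Suc.prems fs by auto
    \<comment> \<open>Back-substitution: the value at \<open>p\<close> is the one that solves the
      pivot equation.\<close>
    define y where "y = z(p := - (\<Sum>x\<in>U. g x * z x) / g p)"
    have y: "(\<Sum>x\<in>W. f x * y x) = f p * (- (\<Sum>x\<in>U. g x * z x) / g p) + (\<Sum>x\<in>U. f x * z x)" for f
    proof -
      have "(\<Sum>x\<in>U. f x * y x) = (\<Sum>x\<in>U. f x * z x)"
        using W by (intro sum.cong) (auto simp: y_def)
      then show ?thesis using W by (simp add: y_def)
    qed
    have el: "(\<Sum>x\<in>U. elim f x * z x) = (\<Sum>x\<in>U. f x * z x) - f p / g p * (\<Sum>x\<in>U. g x * z x)" for f
      by (simp add: elim_def algebra_simps sum_subtractf sum_distrib_left)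
    have "(\<Sum>x\<in>W. g x * y x) = 0" using p unfolding y by simp
    moreover have "(\<Sum>x\<in>W. f x * y x) = 0" if "f \<in> set gs" for f
      using z(2) that unfolding y by (auto simp: el)
    moreover have "\<exists>x\<in>W. y x \<noteq> 0" using z(1) W by (auto simp: y_def)
    ultimately show ?thesis using fs by auto
  qed
qed

text \<open>Termwise \<open>2 * (z x * z y) \<le> p x y * (z x)\<^sup>2 + p y x * (z
  y)\<^sup>2\<close> for reciprocal weights. The weights play the part of a diagonal rescaling
  before comparing with row sums; they are constrained only on edges, so a degenerate weight between
  nonadjacent points is harmless.\<close>

lemma weighted_quadratic_form_bound:
  fixes mu p :: "'a \<Rightarrow> 'a \<Rightarrow> real"
  assumes sym: "\<And>x y. mu x y = mu y x" and nonneg: "\<And>x y. 0 \<le> mu x y"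
    and p: "\<And>x y. x \<in> W \<Longrightarrow> y \<in> W \<Longrightarrow> mu x y \<noteq> 0 \<Longrightarrow> 0 < p x y \<and> p x y * p y x = 1"
  shows "(\<Sum>x\<in>W. \<Sum>y\<in>W. mu x y * (z x * z y)) \<le> (\<Sum>x\<in>W. (z x)\<^sup>2 * (\<Sum>y\<in>W. p x y * mu x y))"
proof -
  define h where "h = (\<lambda>x y. (z x)\<^sup>2 * (p x y * mu x y))"
  have "2 * (mu x y * (z x * z y)) \<le> h x y + h y x" if "x \<in> W" "y \<in> W" for x y
  proof (cases "mu x y = 0")
    case False
    then have q: "0 < p x y" "p x y * p y x = 1" using p that by auto
    have "0 \<le> (p x y * z x - z y)\<^sup>2" by simp
    then have "p x y * (2 * (z x * z y)) \<le> p x y * (p x y * (z x)\<^sup>2) + (p x y * p y x) * (z y)\<^sup>2"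
      unfolding q(2) by (simp add: power2_eq_square algebra_simps)
    also have "\<dots> = p x y * (p x y * (z x)\<^sup>2 + p y x * (z y)\<^sup>2)" by (simp add: algebra_simps)
    finally have "2 * (z x * z y) \<le> p x y * (z x)\<^sup>2 + p y x * (z y)\<^sup>2" using q by simp
    then have "mu x y * (2 * (z x * z y)) \<le> mu x y * (p x y * (z x)\<^sup>2 + p y x * (z y)\<^sup>2)"
      using nonneg by (rule mult_left_mono)
    then show ?thesis using sym[of x y] by (simp add: h_def algebra_simps)
  qed (use sym[of x y] in \<open>simp add: h_def\<close>)
  then have "(\<Sum>x\<in>W. \<Sum>y\<in>W. 2 * (mu x y * (z x * z y))) \<le> (\<Sum>x\<in>W. \<Sum>y\<in>W. h x y + h y x)"
    by (intro sum_mono) auto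
  also have "\<dots> = 2 * (\<Sum>x\<in>W. \<Sum>y\<in>W. h x y)"
    using sum.swap[of "\<lambda>x y. h y x" W W] by (simp add: sum.distrib)
  finally have "2 * (\<Sum>x\<in>W. \<Sum>y\<in>W. mu x y * (z x * z y)) \<le> 2 * (\<Sum>x\<in>W. \<Sum>y\<in>W. h x y)"
    unfolding sum_distrib_left .
  then have "(\<Sum>x\<in>W. \<Sum>y\<in>W. mu x y * (z x * z y)) \<le> (\<Sum>x\<in>W. \<Sum>y\<in>W. h x y)" by linarith
  also have "\<dots> = (\<Sum>x\<in>W. (z x)\<^sup>2 * (\<Sum>y\<in>W. p x y * mu x y))"
    by (simp add: h_def sum_distrib_left)
  finally show ?thesis .
qed

section \<open>Incidence counts and the leave multigraph\<close>

definition point_degree :: "'a set multiset \<Rightarrow> 'a \<Rightarrow> nat" where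
  "point_degree \<B> x = size {# b \<in># \<B>. x \<in> b #}"

definition pair_count :: "'a set multiset \<Rightarrow> 'a \<Rightarrow> 'a \<Rightarrow> nat" where
  "pair_count \<B> x y = size {# b \<in># \<B>. x \<in> b \<and> y \<in> b #}"

text \<open>The loopless multigraph of missing covers. For distinct points of a packing the
  truncated subtraction is exact.\<close>

definition leave :: "nat \<Rightarrow> 'a set multiset \<Rightarrow> 'a \<Rightarrow> 'a \<Rightarrow> nat" where
  "leave l \<B> x y = (if x = y then 0 else l - pair_count \<B> x y)"

lemma pair_count_commute: "pair_count \<B> x y = pair_count \<B> y x"
  by (simp add: pair_count_def conj_commute)

lemma leave_commute: "leave l \<B> x y = leave l \<B> y x"
  by (simp add: leave_def pair_count_commute[of \<B> x y])

lemma leave_self: "leave l \<B> x x = 0"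
  by (simp add: leave_def)

lemma pair_count_self: "pair_count \<B> x x = point_degree \<B> x"
  by (simp add: pair_count_def point_degree_def)

text \<open>The pair counts, with point degrees on the diagonal, are the Gram matrix of the
  incidence rows; each block contributes a rank-one square.\<close>

lemma gram_form:
  fixes z :: "'a \<Rightarrow> real"
  shows "(\<Sum>x\<in>W. \<Sum>y\<in>W. real (pair_count \<B> x y) * (z x * z y))
       = (\<Sum>b\<in>#\<B>. (\<Sum>x\<in>W. of_bool (x \<in> b) * z x)\<^sup>2)"
proof (induction \<B>)
  case (add c \<B>)
  have "real (pair_count (add_mset c \<B>) x y) = of_bool (x \<in> c) * of_bool (y \<in> c) + real (pair_count \<B> x y)"
    for x y by (simp add: pair_count_def)
  then show ?case using add
    by (simp add: algebra_simps sum.distrib power2_eq_square sum_product)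
qed (simp add: pair_count_def)

lemma sum_point_degree:
  assumes "packing v k l V \<B>"
  shows "(\<Sum>x\<in>V. point_degree \<B> x) = k * size \<B>"
proof -
  have fV: "finite V" using assms by (simp add: packing_def)
  have "\<forall>b\<in>#\<B>. b \<subseteq> V \<and> card b = k \<Longrightarrow> (\<Sum>x\<in>V. point_degree \<B> x) = k * size \<B>"
  proof (induction \<B>)
    case (add c \<B>)
    have "point_degree (add_mset c \<B>) x = (if x \<in> c then 1 else 0) + point_degree \<B> x" for x
      by (simp add: point_degree_def)
    moreover have "(\<Sum>x\<in>V. if x \<in> c then 1 else 0) = k"
      using add.prems fV by (simp add: sum.If_cases Int_absorb1)
    ultimately show ?case using add by (simp add: sum.distrib)
  qed (simp add: point_degree_def)
  then show ?thesis using assms by (simp add: packing_def)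
qed

lemma sum_pair_count:
  assumes "packing v k l V \<B>" "x \<in> V"
  shows "(\<Sum>y\<in>V - {x}. pair_count \<B> x y) = (k - 1) * point_degree \<B> x"
proof -
  have fV: "finite V" using assms by (simp add: packing_def)
  have "\<forall>b\<in>#\<B>. b \<subseteq> V \<and> card b = k \<Longrightarrow> (\<Sum>y\<in>V - {x}. pair_count \<B> x y) = (k - 1) * point_degree \<B> x"
  proof (induction \<B>)
    case (add c \<B>)
    have *: "pair_count (add_mset c \<B>) x y = (if x \<in> c \<and> y \<in> c then 1 else 0) + pair_count \<B> x y" for y
      by (simp add: pair_count_def)
    have "(\<Sum>y\<in>V - {x}. if x \<in> c \<and> y \<in> c then 1 else 0) = (if x \<in> c then k - 1 else 0)"
    proof (cases "x \<in> c")
      case True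
      have c: "c \<subseteq> V" "card c = k" using add.prems by auto
      have "(\<Sum>y\<in>V - {x}. if x \<in> c \<and> y \<in> c then 1 else 0) = card ((V - {x}) \<inter> {y. y \<in> c})"
        using True fV by (simp add: sum.If_cases)
      also have "(V - {x}) \<inter> {y. y \<in> c} = c - {x}" using c by auto
      finally show ?thesis using True c by simp
    qed simp
    then show ?case using add by (simp add: * sum.distrib point_degree_def)
  qed (simp add: point_degree_def pair_count_def)
  then show ?thesis using assms by (simp add: packing_def)
qed

lemma leave_degree:
  assumes P: "packing v k l V \<B>" and x: "x \<in> V" and k: "1 \<le> k"
  shows "(\<Sum>y\<in>V. real (leave l \<B> x y)) = real l * (real v - 1) - (real k - 1) * real (point_degree \<B> x)"
proof -
  have fV: "finite V" "card V = v" using P by (auto simp: packing_def)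
  have "v \<ge> 1" using fV x by (metis One_nat_def Suc_leI card_gt_0_iff empty_iff)
  have "(\<Sum>y\<in>V. real (leave l \<B> x y)) = (\<Sum>y\<in>V - {x}. real (leave l \<B> x y))"
    using fV x by (simp add: sum.remove leave_self)
  also have "\<dots> = (\<Sum>y\<in>V - {x}. real l - real (pair_count \<B> x y))"
    using P x by (intro sum.cong) (auto simp: leave_def packing_def pair_count_def of_nat_diff)
  also have "\<dots> = real l * (real v - 1) - real (\<Sum>y\<in>V - {x}. pair_count \<B> x y)"
    using fV x \<open>v \<ge> 1\<close> by (simp add: sum_subtractf of_nat_diff)
  also have "\<dots> = real l * (real v - 1) - (real k - 1) * real (point_degree \<B> x)"
    using k unfolding sum_pair_count[OF P x] by (simp add: of_nat_diff)
  finally show ?thesis .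
qed

text \<open>With more points than blocks, some nonzero \<open>z\<close> on \<open>W\<close> is
  orthogonal to every block, and the Gram form vanishes at it.\<close>

lemma card_le_size_if_gram_positive:
  assumes fin: "finite W"
    and pos: "\<And>z. \<exists>x\<in>W. z x \<noteq> 0 \<Longrightarrow>
      (0::real) < (\<Sum>x\<in>W. \<Sum>y\<in>W. real (pair_count \<B> x y) * (z x * z y))"
  shows "card W \<le> size \<B>"
proof (rule ccontr)
  obtain bs where bs: "mset bs = \<B>" using ex_mset by blast
  assume "\<not> card W \<le> size \<B>"
  then have "length (map (\<lambda>b x. of_bool (x \<in> b) :: real) bs) < card W" using bs by auto
  from nontrivial_solution[OF fin this] obtain z where z: "\<exists>x\<in>W. z x \<noteq> 0"
    "\<forall>b\<in>set bs. (\<Sum>x\<in>W. of_bool (x \<in> b) * z x) = (0::real)" by auto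
  have "(\<Sum>b\<in>#\<B>. (\<Sum>x\<in>W. of_bool (x \<in> b) * z x)\<^sup>2) = (\<Sum>b\<in>#\<B>. (0::real))"
    using z(2) bs by (intro arg_cong[where f = sum_mset] image_mset_cong) auto
  then show False using pos[OF z(1)] by (simp add: gram_form)
qed

text \<open>The Gram matrix of the point rows is \<open>l J + diag (degree - l) - leave\<close>; after a suitable
  diagonal rescaling the last two terms form a diagonally dominant matrix.\<close>

lemma independent_points:
  assumes P: "packing v k l V \<B>" and AS: "A \<subseteq> V" "S \<subseteq> V" "A \<inter> S = {}"
    and d: "0 \<le> d" "d < n"
    and A: "\<And>x. x \<in> A \<Longrightarrow> real (point_degree \<B> x) = real l + n"
      "\<And>x. x \<in> A \<Longrightarrow> (\<Sum>y\<in>V. real (leave l \<B> x y)) \<le> d"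
    and S: "\<And>x. x \<in> S \<Longrightarrow> real (point_degree \<B> x) = real l + m"
      "\<And>x. x \<in> S \<Longrightarrow>
        (\<Sum>y\<in>S. real (leave l \<B> x y)) + d / n * (\<Sum>y\<in>A. real (leave l \<B> x y)) < m"
  shows "card A + card S \<le> size \<B>"
proof -
  have fV: "finite V" using P by (simp add: packing_def)
  define W where "W = A \<union> S"
  have fin: "finite A" "finite S" "finite W" using fV AS by (auto simp: W_def intro: finite_subset)
  define e where "e = (\<lambda>x. real (point_degree \<B> x) - real l)"
  define mu where "mu = (\<lambda>x y. real (leave l \<B> x y))"
  have sumW: "(\<Sum>y\<in>W. f y) = (\<Sum>y\<in>A. f y) + (\<Sum>y\<in>S. f y)" for f :: "'a \<Rightarrow> real"
    unfolding W_def using fin AS by (intro sum.union_disjoint) auto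
  have degA: "(\<Sum>y\<in>A. mu x y) + (\<Sum>y\<in>S. mu x y) \<le> d" if "x \<in> A" for x
  proof -
    have "(\<Sum>y\<in>W. mu x y) \<le> (\<Sum>y\<in>V. mu x y)"
      using fV AS by (intro sum_mono2) (auto simp: W_def mu_def)
    then show ?thesis using A(2)[OF that] by (simp add: sumW mu_def)
  qed
  have mu_le: "mu x y \<le> d" if "x \<in> A" "y \<in> S" for x y
  proof -
    have "mu x y \<le> (\<Sum>y\<in>S. mu x y)"
      using that fin by (intro member_le_sum) (auto simp: mu_def)
    moreover have "0 \<le> (\<Sum>y\<in>A. mu x y)" by (intro sum_nonneg) (simp add: mu_def)
    ultimately show ?thesis using degA[OF that(1)] by linarith
  qed
  have "card W \<le> size \<B>"
  proof (rule card_le_size_if_gram_positive[OF fin(3)])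
    fix z :: "'a \<Rightarrow> real"
    assume z: "\<exists>x\<in>W. z x \<noteq> 0"
    have pc: "real (pair_count \<B> x y) = real l - mu x y + (if x = y then e x else 0)" if "x \<in> W" "y \<in> W" for x y
    proof -
      have "x \<noteq> y \<longrightarrow> pair_count \<B> x y \<le> l"
        using P that AS unfolding packing_def pair_count_def W_def by blast
      then show ?thesis
        by (auto simp: mu_def e_def leave_def pair_count_self of_nat_diff)
    qed
    have "(\<Sum>x\<in>W. \<Sum>y\<in>W. real (pair_count \<B> x y) * (z x * z y))
      = (\<Sum>x\<in>W. \<Sum>y\<in>W. real l * (z x * z y) - mu x y * (z x * z y) + (if x = y then e x * (z x * z y) else 0))"
      by (intro sum.cong refl) (simp add: pc algebra_simps)
    also have "\<dots> = real l * (\<Sum>x\<in>W. z x)\<^sup>2 - (\<Sum>x\<in>W. \<Sum>y\<in>W. mu x y * (z x * z y)) + (\<Sum>x\<in>W. (z x)\<^sup>2 * e x)"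
      using fin by (simp add: sum.distrib sum_subtractf power2_eq_square sum_product sum_distrib_left mult.commute mult.left_commute)
    finally have gram: "(\<Sum>x\<in>W. \<Sum>y\<in>W. real (pair_count \<B> x y) * (z x * z y)) =
      real l * (\<Sum>x\<in>W. z x)\<^sup>2 - (\<Sum>x\<in>W. \<Sum>y\<in>W. mu x y * (z x * z y)) + (\<Sum>x\<in>W. (z x)\<^sup>2 * e x)" .
    obtain p :: "'a \<Rightarrow> 'a \<Rightarrow> real" where
      p: "\<And>x y. x \<in> W \<Longrightarrow> y \<in> W \<Longrightarrow> mu x y \<noteq> 0 \<Longrightarrow> 0 < p x y \<and> p x y * p y x = 1"
      and le: "\<And>x. x \<in> W \<Longrightarrow> (z x)\<^sup>2 * (\<Sum>y\<in>W. p x y * mu x y) \<le> (z x)\<^sup>2 * e x"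
      and less: "\<exists>x\<in>W. (z x)\<^sup>2 * (\<Sum>y\<in>W. p x y * mu x y) < (z x)\<^sup>2 * e x"
    \<comment> \<open>Strictness is needed in one row where \<open>z\<close> does not vanish. The
      rescaled rows are strict on \<open>S\<close> but only weak on \<open>A\<close>; if
      \<open>z\<close> vanishes on \<open>S\<close>, unit weights are strict on \<open>A\<close>
      since \<open>d < n\<close>.\<close>
    proof (cases "\<exists>x\<in>S. z x \<noteq> 0")
      case True
      \<comment> \<open>The factor \<open>n / d\<close> inflates a row sum of at most
        \<open>d\<close> to at most the excess \<open>n\<close> of a full point. For
        \<open>d = 0\<close> it is \<open>0\<close> by convention, but then \<open>mu_le\<close>
        rules out edges between \<open>A\<close> and \<open>S\<close>.\<close>
      define p where "p = (\<lambda>x y. if x \<in> A \<and> y \<in> S then n / d else if x \<in> S \<and> y \<in> A then d / n else 1)"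
      have pS: "(\<Sum>y\<in>W. p x y * mu x y) < e x" if "x \<in> S" for x
      proof -
        have "(\<Sum>y\<in>A. p x y * mu x y) = d / n * (\<Sum>y\<in>A. mu x y)"
          unfolding sum_distrib_left using that AS by (intro sum.cong) (auto simp: p_def)
        moreover have "(\<Sum>y\<in>S. p x y * mu x y) = (\<Sum>y\<in>S. mu x y)"
          using that AS by (intro sum.cong) (auto simp: p_def)
        ultimately show ?thesis using S[OF that] by (simp add: sumW e_def mu_def)
      qed
      have pA: "(\<Sum>y\<in>W. p x y * mu x y) \<le> e x" if "x \<in> A" for x
      proof -
        have 1: "(\<Sum>y\<in>A. p x y * mu x y) = (\<Sum>y\<in>A. mu x y)"
          using that AS by (intro sum.cong) (auto simp: p_def)
        have 2: "(\<Sum>y\<in>S. p x y * mu x y) = n / d * (\<Sum>y\<in>S. mu x y)"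
          unfolding sum_distrib_left using that AS by (intro sum.cong) (auto simp: p_def)
        have nn: "0 \<le> (\<Sum>y\<in>A. mu x y)" by (intro sum_nonneg) (simp add: mu_def)
        have "(\<Sum>y\<in>W. p x y * mu x y) \<le> n"
        proof (cases "d = 0")
          case True
          moreover have "0 \<le> (\<Sum>y\<in>S. mu x y)" by (intro sum_nonneg) (simp add: mu_def)
          ultimately show ?thesis using 1 2 degA[OF that] d by (simp add: sumW)
        next
          case False
          have "(\<Sum>y\<in>A. mu x y) \<le> n / d * (\<Sum>y\<in>A. mu x y)"
            using mult_right_mono[OF _ nn, of 1 "n / d"] d False by simp
          then have "(\<Sum>y\<in>W. p x y * mu x y) \<le> n / d * ((\<Sum>y\<in>A. mu x y) + (\<Sum>y\<in>S. mu x y))"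
            using 1 2 by (simp add: sumW distrib_left)
          also have "\<dots> \<le> n / d * d" using degA[OF that] d by (intro mult_left_mono) auto
          finally show ?thesis using False by simp
        qed
        then show ?thesis using A(1)[OF that] by (simp add: e_def)
      qed
      show thesis
      proof (rule that[of p])
        fix x y assume "x \<in> W" "y \<in> W" "mu x y \<noteq> 0"
        moreover have "mu x y \<ge> 0" "mu y x = mu x y" by (simp_all add: mu_def leave_commute)
        ultimately show "0 < p x y \<and> p x y * p y x = 1"
          using mu_le[of x y] mu_le[of y x] d AS by (auto simp: p_def W_def)
      next
        fix x assume "x \<in> W"
        then have "(\<Sum>y\<in>W. p x y * mu x y) \<le> e x" using pA pS by (force simp: W_def)
        then show "(z x)\<^sup>2 * (\<Sum>y\<in>W. p x y * mu x y) \<le> (z x)\<^sup>2 * e x" by (intro mult_left_mono) auto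
      next
        obtain x where "x \<in> S" "z x \<noteq> 0" using True by auto
        then show "\<exists>x\<in>W. (z x)\<^sup>2 * (\<Sum>y\<in>W. p x y * mu x y) < (z x)\<^sup>2 * e x"
          using pS by (intro bexI[of _ x] mult_strict_left_mono) (auto simp: W_def)
      qed
    next
      case False
      have pA: "(\<Sum>y\<in>W. 1 * mu x y) < e x" if "x \<in> A" for x
        using degA[OF that] A(1)[OF that] d by (simp add: sumW e_def)
      show thesis
      proof (rule that[of "\<lambda>_ _. 1"])
        fix x assume "x \<in> W"
        then show "(z x)\<^sup>2 * (\<Sum>y\<in>W. 1 * mu x y) \<le> (z x)\<^sup>2 * e x"
          using False pA[of x] by (cases "x \<in> A") (auto simp: W_def intro!: mult_left_mono)
      next
        obtain x where "x \<in> A" "z x \<noteq> 0" using z False by (auto simp: W_def)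
        then show "\<exists>x\<in>W. (z x)\<^sup>2 * (\<Sum>y\<in>W. 1 * mu x y) < (z x)\<^sup>2 * e x"
          using pA by (intro bexI[of _ x] mult_strict_left_mono) (auto simp: W_def)
      qed auto
    qed
    have "(\<Sum>x\<in>W. \<Sum>y\<in>W. mu x y * (z x * z y)) \<le> (\<Sum>x\<in>W. (z x)\<^sup>2 * (\<Sum>y\<in>W. p x y * mu x y))"
      by (intro weighted_quadratic_form_bound p) (auto simp: mu_def leave_commute)
    also have "\<dots> < (\<Sum>x\<in>W. (z x)\<^sup>2 * e x)"
      using fin le less by (intro sum_strict_mono_ex1) auto
    finally have "(\<Sum>x\<in>W. \<Sum>y\<in>W. mu x y * (z x * z y)) < (\<Sum>x\<in>W. (z x)\<^sup>2 * e x)" .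
    moreover have "0 \<le> real l * (\<Sum>x\<in>W. z x)\<^sup>2" by simp
    ultimately show "0 < (\<Sum>x\<in>W. \<Sum>y\<in>W. real (pair_count \<B> x y) * (z x * z y))"
      unfolding gram by linarith
  qed
  then show ?thesis unfolding W_def using fin AS by (simp add: card_Un_disjoint)
qed

section \<open>Packing bounds\<close>

text \<open>With \<open>y = e1 + d / n * e0 + 1\<close> and \<open>B = d / (2 (n - 1) (n - d))\<close>, the right-hand side is at least
  \<open>n / (2 y) + B y - B (d + k)\<close>, and the square root arises from the arithmetic-geometric mean inequality.\<close>

lemma sqrt_bound_le_caro_tuza:
  fixes d n k e0 e1 :: real
  assumes n: "1 < n" and d: "0 \<le> d" "d < n / 2" and e: "0 \<le> e0" "e0 + e1 \<le> d + k - 1"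
  shows "sqrt (d * n / ((n - 1) * (n - d))) - d * (d + k) / (2 * (n - 1) * (n - d))
    \<le> caro_tuza (n - 1) (e1 + d / n * e0) - d / n * e0 / (2 * (n - 1))"
proof -
  define m where "m = n - 1"
  define B where "B = d / (2 * m * (n - d))"
  define x where "x = e1 + d / n * e0"
  have m: "0 < m" using n by (simp add: m_def)
  have nd: "0 < n - d" using d n by simp
  have B0: "0 \<le> B" unfolding B_def using m nd d by simp
  have Bn: "d * n / ((n - 1) * (n - d)) = 2 * B * n"
    by (simp add: B_def flip: m_def)
  \<comment> \<open>\<open>B\<close> is chosen so that \<open>B * (n - d) / n\<close> equals
    \<open>d / n / (2 * m)\<close>: the discount is paid from the amount by which \<open>x\<close>
    falls short of \<open>d + k - 1\<close>, which is at least
    \<open>(1 - d / n) * e0\<close>.\<close>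
  have cost: "d / n * e0 / (2 * m) \<le> B * (d + k - 1 - x)"
  proof -
    have "(n - d) / n = 1 - d / n" using n by (simp add: diff_divide_distrib)
    then have "(n - d) / n * e0 = e0 - d / n * e0" by (simp add: left_diff_distrib)
    then have "(n - d) / n * e0 \<le> d + k - 1 - x" using e unfolding x_def by linarith
    then have "B * ((n - d) / n * e0) \<le> B * (d + k - 1 - x)"
      using B0 by (rule mult_left_mono)
    moreover have "B * ((n - d) / n * e0) = d / n * e0 / (2 * m)"
      using nd n m by (simp add: B_def)
    ultimately show ?thesis by simp
  qed
  have amgm: "sqrt (2 * B * n) \<le> n / (2 * y) + B * y" if "0 < y" for y
  proof -
    have "2 * B * n = (n / y) * (2 * B * y)" using that by simp
    also have "sqrt \<dots> \<le> (n / y + 2 * B * y) / 2"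
      using that n B0 by (intro arith_geo_mean_sqrt) auto
    finally show ?thesis by (simp add: add_divide_distrib mult.commute)
  qed
  have "sqrt (2 * B * n) \<le> caro_tuza m x + B * (x + 1)"
  proof (cases "m \<le> x")
    case True
    then show ?thesis using amgm[of "x + 1"] m by (simp add: caro_tuza_ge) (simp add: m_def)
  next
    case False
    \<comment> \<open>This is where \<open>d < n / 2\<close> enters. It makes
      \<open>caro_tuza m x + B * (x + 1)\<close> nonincreasing on the linear branch, so the value at
      \<open>x = m\<close> is the least, and there \<open>amgm\<close> applies with
      \<open>y = n\<close>.\<close>
    have "B \<le> 1 / (2 * m)"
    proof -
      have "d / (2 * m * (n - d)) \<le> (n - d) / (2 * m * (n - d))"
        using d m nd by (intro divide_right_mono) auto
      then show ?thesis using nd by (simp add: B_def)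
    qed
    then have "(m - x) * B \<le> (m - x) * (1 / (2 * m))" using False by (intro mult_left_mono) auto
    moreover have "(m - x) * (1 / (2 * m)) = 1 / 2 - x / (2 * m)" using m by (simp add: field_simps)
    moreover have "sqrt (2 * B * n) \<le> 1 / 2 + B * (m + 1)"
      using amgm[of n] n by (simp add: m_def)
    moreover have "(m - x) * B = m * B - x * B" "B * (m + 1) = m * B + B" "B * (x + 1) = x * B + B"
      by (simp_all add: algebra_simps)
    moreover have "caro_tuza m x = 1 - x / (2 * m)" using False by (simp add: caro_tuza_def)
    ultimately show ?thesis by argo
  qed
  moreover have "d * (d + k) / (2 * (n - 1) * (n - d)) = B * (d + k)"
    by (simp add: B_def m_def)
  moreover have "B * (x + 1) + B * (d + k - 1 - x) = B * (d + k)" by (simp add: algebra_simps)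
  ultimately show ?thesis using cost unfolding Bn x_def m_def by linarith
qed

text \<open>The instance \<open>e0 = 0\<close>, \<open>e1 = d + k - 1\<close>, where the Caro-Tuza
  value is \<open>n / (2 * (d + k))\<close>. It supplies the condition
  \<open>2 * \<beta> \<le> \<alpha>\<close> of \<open>size_le_DB\<close> for (c).\<close>

lemma sqrt_bound_le_half:
  fixes d n k :: real
  assumes n: "1 < n" and d: "0 \<le> d" "d < n / 2" and k: "n \<le> d + k"
  shows "sqrt (d * n / ((n - 1) * (n - d))) - d * (d + k) / (2 * (n - 1) * (n - d)) \<le> 1 / 2"
proof -
  have "sqrt (d * n / ((n - 1) * (n - d))) - d * (d + k) / (2 * (n - 1) * (n - d))
    \<le> caro_tuza (n - 1) ((d + k - 1) + d / n * 0) - d / n * 0 / (2 * (n - 1))"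
    using assms by (intro sqrt_bound_le_caro_tuza) auto
  also have "\<dots> \<le> 1 / 2" using assms by (simp add: caro_tuza_ge)
  finally show ?thesis .
qed

section \<open>Full and deficient points of a packing\<close>

locale dense_packing =
  fixes v k l :: nat and V :: "'a set" and \<B> :: "'a set multiset" and r d n :: int
  assumes packing: "packing v k l V \<B>"
    and l_pos: "0 < l" and k_ge: "3 \<le> k" and k_less: "k < v"
    and replication: "int l * (int v - 1) = r * (int k - 1) + d"
    and d_nonneg: "0 \<le> d" and d_less: "d < int k - 1"
    and n_def: "n = r - int l" and r_less: "r < int k" and d_less_n: "d < n"
begin

definition full :: "'a set" where "full = {x \<in> V. int (point_degree \<B> x) = r}"

definition deficient :: "'a set" where "deficient = {x \<in> V. int (point_degree \<B> x) = r - 1}"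

lemma finite_points: "finite V" "finite full" "finite deficient"
  using packing by (auto simp: packing_def full_def deficient_def)

lemma replication_real: "real l * (real v - 1) = of_int r * (real k - 1) + of_int d"
proof -
  have "real_of_int (int l * (int v - 1)) = real_of_int (r * (int k - 1) + d)"
    by (simp only: replication)
  then show ?thesis by simp
qed

lemma leave_degree_deficit:
  assumes "x \<in> V"
  shows "(\<Sum>y\<in>V. real (leave l \<B> x y)) = (of_int r - real (point_degree \<B> x)) * (real k - 1) + of_int d"
  using leave_degree[OF packing assms] k_ge unfolding replication_real by (simp add: algebra_simps)

text \<open>A degree above \<open>r\<close> would make the leave degree at most
  \<open>d - (k - 1)\<close>, which is negative.\<close>

lemma point_degree_le:
  assumes "x \<in> V"
  shows "int (point_degree \<B> x) \<le> r"
proof (rule ccontr)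
  assume "\<not> int (point_degree \<B> x) \<le> r"
  then have u: "of_int r - real (point_degree \<B> x) \<le> - 1" by linarith
  define t where "t = (of_int r - real (point_degree \<B> x)) * (real k - 1)"
  have "t \<le> - (real k - 1)"
    using mult_right_mono[OF u, of "real k - 1"] k_ge unfolding t_def by simp
  moreover have "real_of_int d < real k - 1" using d_less by linarith
  moreover have "0 \<le> (\<Sum>y\<in>V. real (leave l \<B> x y))" by (intro sum_nonneg) simp
  ultimately show False unfolding leave_degree_deficit[OF assms] t_def[symmetric] by argo
qed

lemma floor_replication: "\<lfloor>real l * (real v - 1) / (real k - 1)\<rfloor> = r"
proof -
  have "real_of_int d < real k - 1" using d_less by linarith
  then show ?thesis
    using k_ge d_nonneg unfolding replication_real
    by (intro floor_unique) (simp_all add: field_simps)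
qed

text \<open>The pointwise inequality \<open>point\<close> is summed over all points. It is an
  equality on full and deficient points; a point missing two or more blocks needs
  \<open>2 * \<beta> \<le> \<alpha>\<close>. The total shortfall is
  \<open>r * v - k * size \<B>\<close>, and \<open>gap\<close> makes the denominator of
  \<open>DB\<close> positive.\<close>

lemma size_le_DB:
  assumes bound: "\<alpha> * real (card full) + \<beta> * real (card deficient) \<le> real (size \<B>)"
    and \<beta>: "2 * \<beta> \<le> \<alpha>" and gap: "1 / real k < \<alpha> - \<beta>"
  shows "real (size \<B>) \<le> DB v k l \<alpha> \<beta>"
proof -
  define u where "u = (\<lambda>x. of_int r - real (point_degree \<B> x))"
  have cV: "card V = v" using packing by (simp add: packing_def)
  have "0 < 1 / real k" using k_ge by simp
  then have gap0: "0 < \<alpha> - \<beta>" using gap by linarith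
  have point: "\<alpha> \<le> (\<alpha> - \<beta>) * u x + (if x \<in> full then \<alpha> else 0) + (if x \<in> deficient then \<beta> else 0)"
    if x: "x \<in> V" for x
  proof -
    have ux: "u x = of_int (r - int (point_degree \<B> x))" by (simp add: u_def)
    consider "int (point_degree \<B> x) = r" | "int (point_degree \<B> x) = r - 1" | "int (point_degree \<B> x) \<le> r - 2"
      using point_degree_le[OF x] by linarith
    then consider "u x = 0" "x \<in> full" "x \<notin> deficient" | "u x = 1" "x \<in> deficient" "x \<notin> full"
      | "2 \<le> u x" "x \<notin> full" "x \<notin> deficient"
      unfolding ux using x by cases (auto simp: full_def deficient_def)
    then show ?thesis
    proof cases
      case 3
      have "(\<alpha> - \<beta>) * 2 \<le> (\<alpha> - \<beta>) * u x" using 3 gap0 by (intro mult_left_mono) auto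
      then show ?thesis using 3 \<beta> by simp
    qed auto
  qed
  have "(\<Sum>x\<in>V. \<alpha>) \<le> (\<Sum>x\<in>V. (\<alpha> - \<beta>) * u x + (if x \<in> full then \<alpha> else 0) + (if x \<in> deficient then \<beta> else 0))"
    by (intro sum_mono point)
  also have "\<dots> = (\<alpha> - \<beta>) * (\<Sum>x\<in>V. u x) + \<alpha> * real (card full) + \<beta> * real (card deficient)"
  proof -
    have "V \<inter> full = full" "V \<inter> deficient = deficient" by (auto simp: full_def deficient_def)
    then show ?thesis using finite_points by (simp add: sum.distrib sum_distrib_left sum.If_cases)
  qed
  also have "(\<Sum>x\<in>V. u x) = of_int r * real v - real k * real (size \<B>)"
    using sum_point_degree[OF packing] cV
    by (simp add: u_def sum_subtractf flip: of_nat_sum)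
  finally have "\<alpha> * real v \<le> (\<alpha> - \<beta>) * (of_int r * real v - real k * real (size \<B>)) + real (size \<B>)"
    using bound cV by (simp add: mult.commute)
  then have "real (size \<B>) * (real k * (\<alpha> - \<beta>) - 1) \<le> of_int r * real v * (\<alpha> - \<beta>) - \<alpha> * real v"
    by (simp add: algebra_simps)
  moreover have "0 < real k * (\<alpha> - \<beta>) - 1" using gap k_ge by (simp add: field_simps)
  ultimately show ?thesis
    unfolding DB_def Let_def floor_replication by (simp add: pos_le_divide_eq)
qed

lemma n_less: "n \<le> int k - 2"
  using n_def r_less l_pos by linarith

lemma full_leave_degree:
  assumes "x \<in> full"
  shows "(\<Sum>y\<in>V. real (leave l \<B> x y)) = of_int d"
  using assms leave_degree_deficit[of x] by (auto simp: full_def)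

lemma point_degree_full: "x \<in> full \<Longrightarrow> real (point_degree \<B> x) = real l + of_int n"
  using n_def by (auto simp: full_def)

lemma card_full_le_size: "card full \<le> size \<B>"
proof -
  have "card full + card ({} :: 'a set) \<le> size \<B>"
    by (rule independent_points[OF packing, where d = "of_int d" and n = "of_int n"])
      (use point_degree_full full_leave_degree d_nonneg d_less_n in \<open>auto simp: full_def\<close>)
  then show ?thesis by simp
qed

definition deg_to :: "'a set \<Rightarrow> 'a \<Rightarrow> real" where
  "deg_to X x = (\<Sum>y\<in>X. real (leave l \<B> x y))"

lemma deg_to_nonneg: "0 \<le> deg_to X x"
  unfolding deg_to_def by (intro sum_nonneg) simp

lemma deg_to_deficient_le:
  assumes "x \<in> full"
  shows "deg_to deficient x \<le> of_int d"
proof -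
  have "deg_to deficient x \<le> (\<Sum>y\<in>V. real (leave l \<B> x y))"
    unfolding deg_to_def using finite_points by (intro sum_mono2) (auto simp: deficient_def)
  then show ?thesis using full_leave_degree[OF assms] by simp
qed

lemma deficient_leave_degree:
  assumes "x \<in> deficient"
  shows "deg_to full x + deg_to deficient x \<le> of_int d + real k - 1"
proof -
  have "deg_to full x + deg_to deficient x = (\<Sum>y\<in>full \<union> deficient. real (leave l \<B> x y))"
    unfolding deg_to_def using finite_points
    by (intro sum.union_disjoint[symmetric]) (auto simp: full_def deficient_def)
  also have "\<dots> \<le> (\<Sum>y\<in>V. real (leave l \<B> x y))"
    using finite_points by (intro sum_mono2) (auto simp: full_def deficient_def)
  also have "\<dots> = (of_int r - real (point_degree \<B> x)) * (real k - 1) + of_int d"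
    using assms by (intro leave_degree_deficit) (simp add: deficient_def)
  also have "of_int r - real (point_degree \<B> x) = 1"
    using assms by (simp add: deficient_def)
  finally show ?thesis by simp
qed

text \<open>The sparse set is taken among the deficient points, whose excess over \<open>l\<close>
  is \<open>n - 1\<close>, with leave edges to full points weighted by \<open>d / n\<close>.
  Together with all full points it is independent.\<close>

lemma size_ge:
  assumes n: "1 < n"
  shows "real (card full) + (\<Sum>x\<in>deficient.
      caro_tuza (of_int n - 1) (deg_to deficient x + of_int d / of_int n * deg_to full x)
      - of_int d / of_int n * deg_to full x / (2 * (of_int n - 1))) \<le> real (size \<B>)"
proof -
  define m where "m = real_of_int n - 1"
  have m: "0 < m" using n by (simp add: m_def)
  have w: "0 \<le> of_int d / of_int n * deg_to full x" for x
    using deg_to_nonneg d_nonneg d_less_n by simp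
  from caro_tuza_weighted[where T = deficient and m = m and mu = "leave l \<B>"
      and w = "\<lambda>x. of_int d / of_int n * deg_to full x",
      OF finite_points(3) m leave_commute leave_self w, folded deg_to_def]
  obtain S where S: "S \<subseteq> deficient"
    "\<forall>x\<in>S. deg_to S x + of_int d / of_int n * deg_to full x < m"
    "(\<Sum>x\<in>deficient. caro_tuza m (deg_to deficient x + of_int d / of_int n * deg_to full x)
      - of_int d / of_int n * deg_to full x / (2 * m)) \<le> real (card S)"
    by (elim exE conjE)
  have "card full + card S \<le> size \<B>"
  proof (rule independent_points[OF packing, where d = "of_int d" and n = "of_int n" and m = m])
    show "real (point_degree \<B> x) = real l + of_int n" if "x \<in> full" for x
      using that by (rule point_degree_full)
    show "real (point_degree \<B> x) = real l + m" if "x \<in> S" for x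
    proof -
      have "int (point_degree \<B> x) = int l + n - 1" using that S(1) n_def by (auto simp: deficient_def)
      then show ?thesis unfolding m_def by linarith
    qed
  qed (use S d_nonneg d_less_n full_leave_degree in \<open>auto simp: full_def deficient_def deg_to_def\<close>)
  then show ?thesis using S(3) unfolding m_def by linarith
qed

text \<open>Edges between the two classes are counted from the full end, where the whole leave
  degree is \<open>d\<close>. This moves the charge to the full points in (a).\<close>

lemma sum_deg_to_full:
  "(\<Sum>x\<in>deficient. deg_to full x) \<le> of_int d * real (card full)"
proof -
  have "(\<Sum>x\<in>deficient. deg_to full x) = (\<Sum>y\<in>full. deg_to deficient y)"
    unfolding deg_to_def by (subst sum.swap) (simp add: leave_commute)
  also have "\<dots> \<le> (\<Sum>y\<in>full. of_int d)" by (intro sum_mono deg_to_deficient_le)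
  finally show ?thesis by (simp add: mult.commute)
qed

section \<open>The three bounds\<close>

lemma bound_a:
  assumes n: "1 < n"
  shows "real (size \<B>) \<le> DB v k l (1 - real_of_int d ^ 2 / (2 * real_of_int n * (real_of_int n - 1)))
                (real_of_int n / (2 * (real_of_int d + real k)))"
proof -
  define N D where "N = real_of_int n" and "D = real_of_int d"
  define \<alpha> \<beta> where "\<alpha> = 1 - D\<^sup>2 / (2 * N * (N - 1))" and "\<beta> = N / (2 * (D + real k))"
  define c where "c = D / N / (2 * (N - 1))"
  have ND: "1 < N" "0 \<le> D" "D \<le> N - 1" "N \<le> real k - 2"
    using n d_nonneg d_less_n n_less unfolding N_def D_def by linarith+
  have c0: "0 \<le> c" using ND by (simp add: c_def)
  have \<alpha>_eq: "\<alpha> = 1 - c * D" by (simp add: \<alpha>_def c_def power2_eq_square)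
  \<comment> \<open>Integrality enters as \<open>D \<le> N - 1\<close>.\<close>
  have "D\<^sup>2 / (2 * N * (N - 1)) \<le> D * (N - 1) / (2 * N * (N - 1))"
    unfolding power2_eq_square using ND by (intro divide_right_mono mult_left_mono) auto
  also have "\<dots> = D / (2 * N)" using ND by simp
  finally have \<alpha>: "1 - D / (2 * N) \<le> \<alpha>" by (simp add: \<alpha>_def)
  have "N * (2 * N) \<le> (2 * N - D) * (D + N)"
    using ND mult_left_mono[of D N D] by (simp add: algebra_simps)
  then have "N / (D + N) \<le> 1 - D / (2 * N)"
    using ND by (simp add: field_simps)
  moreover have "N / (D + real k) \<le> N / (D + N)" using ND by (intro divide_left_mono mult_pos_pos) auto
  moreover have "2 * \<beta> = N / (D + real k)" using ND by (simp add: \<beta>_def divide_simps)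
  ultimately have \<beta>: "2 * \<beta> \<le> \<alpha>" using \<alpha> by linarith
  \<comment> \<open>Since \<open>2 * \<beta> \<le> \<alpha>\<close>, the gap
    \<open>\<alpha> - \<beta>\<close> is at least \<open>\<alpha> / 2 > 1 / 4\<close>, and
    \<open>1 < n \<le> k - 2\<close> gives \<open>k \<ge> 4\<close>.\<close>
  have "1 / 2 < 1 - D / (2 * N)" using ND by (simp add: field_simps)
  moreover have "1 / real k \<le> 1 / 4" using n_less n by (intro divide_left_mono) auto
  ultimately have gap: "1 / real k < \<alpha> - \<beta>" using \<alpha> \<beta> by linarith
  \<comment> \<open>\<open>\<beta>\<close> is the Caro-Tuza value at \<open>D + k - 1\<close>, the
    bound on the leave degree of a deficient point within the two classes.\<close>
  have "(\<Sum>x\<in>deficient. \<beta> - D / N * deg_to full x / (2 * (N - 1))) \<le>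
    (\<Sum>x\<in>deficient. caro_tuza (N - 1) (deg_to deficient x + D / N * deg_to full x)
      - D / N * deg_to full x / (2 * (N - 1)))"
  proof (intro sum_mono diff_right_mono)
    fix x assume x: "x \<in> deficient"
    have "D / N * deg_to full x \<le> 1 * deg_to full x"
      using ND deg_to_nonneg by (intro mult_right_mono) auto
    then have "deg_to deficient x + D / N * deg_to full x \<le> D + real k - 1"
      using deficient_leave_degree[OF x] by (simp add: D_def)
    then have "caro_tuza (N - 1) (D + real k - 1) \<le> caro_tuza (N - 1) (deg_to deficient x + D / N * deg_to full x)"
      using ND by (intro caro_tuza_antimono) auto
    moreover have "caro_tuza (N - 1) (D + real k - 1) = \<beta>"
      using ND by (subst caro_tuza_ge) (auto simp: \<beta>_def)
    ultimately show "\<beta> \<le> caro_tuza (N - 1) (deg_to deficient x + D / N * deg_to full x)" by simp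
  qed
  also have "\<dots> \<le> real (size \<B>) - real (card full)"
    using size_ge[OF n] unfolding N_def[symmetric] D_def[symmetric] by linarith
  also have "(\<Sum>x\<in>deficient. \<beta> - D / N * deg_to full x / (2 * (N - 1)))
      = \<beta> * real (card deficient) - c * (\<Sum>x\<in>deficient. deg_to full x)"
    by (simp add: sum_subtractf sum_distrib_left c_def)
  finally have "\<beta> * real (card deficient) - c * (\<Sum>x\<in>deficient. deg_to full x)
      \<le> real (size \<B>) - real (card full)" .
  \<comment> \<open>Each full point pays at most \<open>c * D\<close>, which is
    \<open>1 - \<alpha>\<close>.\<close>
  moreover have "c * (\<Sum>x\<in>deficient. deg_to full x) \<le> c * (D * real (card full))"
    using sum_deg_to_full c0 unfolding D_def by (rule mult_left_mono)
  ultimately have "\<alpha> * real (card full) + \<beta> * real (card deficient) \<le> real (size \<B>)"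
    by (simp add: \<alpha>_eq algebra_simps)
  from size_le_DB[OF this \<beta> gap] show ?thesis
    by (simp add: \<alpha>_def \<beta>_def N_def D_def)
qed

text \<open>For (b) and (c) each deficient point bears its own discount, so full points keep weight
  1 and only a uniform bound \<open>\<beta>\<close> on the summands of \<open>size_ge\<close> is
  needed.\<close>

lemma size_le_DB_one:
  assumes n: "1 < n" and \<beta>: "\<beta> \<le> 1 / 2"
    and le: "\<And>x. x \<in> deficient \<Longrightarrow> \<beta> \<le>
      caro_tuza (of_int n - 1) (deg_to deficient x + of_int d / of_int n * deg_to full x)
      - of_int d / of_int n * deg_to full x / (2 * (of_int n - 1))"
  shows "real (size \<B>) \<le> DB v k l 1 \<beta>"
proof (rule size_le_DB)
  show "1 * real (card full) + \<beta> * real (card deficient) \<le> real (size \<B>)"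
  proof -
    have "(\<Sum>x\<in>deficient. \<beta>) \<le> (\<Sum>x\<in>deficient.
      caro_tuza (of_int n - 1) (deg_to deficient x + of_int d / of_int n * deg_to full x)
      - of_int d / of_int n * deg_to full x / (2 * (of_int n - 1)))"
      by (intro sum_mono le)
    moreover have "(\<Sum>x\<in>deficient. \<beta>) = \<beta> * real (card deficient)" by simp
    ultimately show ?thesis using size_ge[OF n] by linarith
  qed
  show "1 / real k < 1 - \<beta>"
  proof -
    have "1 / real k \<le> 1 / 3" using k_ge by (intro divide_left_mono) auto
    then show ?thesis using \<beta> by linarith
  qed
qed (use \<beta> in simp)

text \<open>By \<open>caro_tuza_ge_linear\<close> a summand is at least
  \<open>1 - (e1 / 2 + d / n * e0) / (n - 1)\<close>. As \<open>d / n \<ge> 1 / 2\<close>, the worst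
  case has all \<open>d + k - 1\<close> edges going to full points.\<close>

lemma bound_b:
  assumes d: "real_of_int n / 2 \<le> real_of_int d"
  shows "real (size \<B>) \<le> DB v k l 1 (1 - real_of_int d * (real_of_int d + real k - 1)
                          / (real_of_int n * (real_of_int n - 1)))"
proof -
  have n: "1 < n" using d d_nonneg d_less_n by linarith
  define N D where "N = real_of_int n" and "D = real_of_int d"
  have ND: "1 < N" "0 \<le> D" "D \<le> N - 1" "N \<le> real k - 2" "N / 2 \<le> D"
    using n d_nonneg d_less_n n_less d unfolding N_def D_def by linarith+
  show ?thesis
  proof (rule size_le_DB_one[OF n], fold N_def D_def)
    have "N / 2 * (N - 1) \<le> D * (D + real k - 1)" using ND by (intro mult_mono) auto
    then show "1 - D * (D + real k - 1) / (N * (N - 1)) \<le> 1 / 2"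
      using ND by (simp add: field_simps)
  next
    fix x assume x: "x \<in> deficient"
    define e0 e1 where "e0 = deg_to full x" and "e1 = deg_to deficient x"
    have e: "0 \<le> e0" "0 \<le> e1" "e0 + e1 \<le> D + real k - 1"
      using deficient_leave_degree[OF x] deg_to_nonneg by (simp_all add: e0_def e1_def D_def)
    have "e1 * (1 / 2) \<le> e1 * (D / N)" using ND e by (intro mult_left_mono) (auto simp: field_simps)
    moreover have "D / N * (e0 + e1) \<le> D / N * (D + real k - 1)"
      using ND e by (intro mult_left_mono) auto
    moreover have "D / N * (e0 + e1) = D / N * e0 + e1 * (D / N)" by (simp add: distrib_left)
    ultimately have "e1 / 2 + D / N * e0 \<le> D / N * (D + real k - 1)" by linarith
    then have "(e1 / 2 + D / N * e0) / (N - 1) \<le> D / N * (D + real k - 1) / (N - 1)"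
      using ND by (intro divide_right_mono) auto
    moreover have "D / N * (D + real k - 1) / (N - 1) = D * (D + real k - 1) / (N * (N - 1))" by simp
    moreover have "(e1 / 2 + D / N * e0) / (N - 1)
        = (e1 + D / N * e0) / (2 * (N - 1)) + D / N * e0 / (2 * (N - 1))"
    proof -
      have "(a / 2 + c) / q = (a + c) / (2 * q) + c / (2 * q)" for a c q :: real
        by (cases "q = 0") (simp_all add: field_simps)
      then show ?thesis .
    qed
    moreover have "1 - (e1 + D / N * e0) / (2 * (N - 1)) \<le> caro_tuza (N - 1) (e1 + D / N * e0)"
      using ND by (intro caro_tuza_ge_linear) auto
    ultimately show "1 - D * (D + real k - 1) / (N * (N - 1)) \<le>
      caro_tuza (N - 1) (deg_to deficient x + D / N * deg_to full x)
      - D / N * deg_to full x / (2 * (N - 1))"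
      unfolding e0_def e1_def by linarith
  qed
qed

lemma bound_c:
  assumes n: "1 < n" and d: "real_of_int d < real_of_int n / 2"
  shows "real (size \<B>) \<le> DB v k l 1 (sqrt (real_of_int d * real_of_int n
                            / ((real_of_int n - 1) * (real_of_int n - real_of_int d)))
                     - real_of_int d * (real_of_int d + real k)
                         / (2 * (real_of_int n - 1) * (real_of_int n - real_of_int d)))"
proof (rule size_le_DB_one[OF n])
  have "real_of_int n \<le> real_of_int d + real k" using n_less d_nonneg by linarith
  then show "sqrt (real_of_int d * real_of_int n / ((real_of_int n - 1) * (real_of_int n - real_of_int d)))
      - real_of_int d * (real_of_int d + real k) / (2 * (real_of_int n - 1) * (real_of_int n - real_of_int d)) \<le> 1 / 2"
    using n d d_nonneg by (intro sqrt_bound_le_half) auto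
next
  fix x assume "x \<in> deficient"
  then show "sqrt (real_of_int d * real_of_int n / ((real_of_int n - 1) * (real_of_int n - real_of_int d)))
      - real_of_int d * (real_of_int d + real k) / (2 * (real_of_int n - 1) * (real_of_int n - real_of_int d))
    \<le> caro_tuza (of_int n - 1) (deg_to deficient x + of_int d / of_int n * deg_to full x)
      - of_int d / of_int n * deg_to full x / (2 * (of_int n - 1))"
    using n d d_nonneg deficient_leave_degree deg_to_nonneg by (intro sqrt_bound_le_caro_tuza) auto
qed

text \<open>For \<open>n = 1\<close> the deficient points have no excess over \<open>l\<close>, so only \<open>\<beta> = 0\<close> is available. Integrality
  of the number of blocks then makes up the difference.\<close>

lemma bound_a_one:
  assumes n: "n = 1"
  shows "real (size \<B>) \<le> DB v k l 1 (1 / (2 * real k))"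
proof -
  have d: "d = 0" and r: "r = int l + 1" using n n_def d_less_n d_nonneg by auto
  define s where "s = int v - int k"
  have ls: "int l * s = int k - 1" using replication d r by (simp add: s_def algebra_simps)
  \<comment> \<open>For \<open>s = 1\<close> the identity \<open>ls\<close> gives
    \<open>l = k - 1\<close>, so \<open>r = k\<close>, against \<open>r < k\<close>.\<close>
  have "s \<ge> 2"
  proof (rule ccontr)
    assume "\<not> s \<ge> 2"
    then have "s = 1" using k_less by (simp add: s_def)
    then show False using ls r r_less by simp
  qed
  have "real (size \<B>) \<le> DB v k l 1 0"
    using card_full_le_size k_ge by (intro size_le_DB) auto
  also have "DB v k l 1 0 = real l * real v / (real k - 1)"
    unfolding DB_def Let_def floor_replication r by (simp add: algebra_simps)
  finally have "real (size \<B>) * (real k - 1) \<le> real l * real v"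
    using k_ge by (simp add: field_simps)
  then have "real_of_int (int (size \<B>) * (int k - 1)) \<le> real_of_int (int l * int v)" by simp
  then have "int l * (int (size \<B>) * s) \<le> int l * int v"
    unfolding of_int_le_iff ls[symmetric] by (simp add: algebra_simps)
  then have "int (size \<B>) * s \<le> int v" using l_pos by simp
  also have "int v = (int l + 1) * s + 1" using ls by (simp add: s_def algebra_simps)
  finally have *: "int (size \<B>) * s \<le> (int l + 1) * s + 1" .
  \<comment> \<open>The surplus 1 over \<open>(l + 1) * s\<close> is too small for another multiple
    of \<open>s \<ge> 2\<close>.\<close>
  have "int (size \<B>) \<le> int l + 1"
  proof (rule ccontr)
    assume "\<not> int (size \<B>) \<le> int l + 1"
    then have "(int l + 2) * s \<le> int (size \<B>) * s" using \<open>s \<ge> 2\<close> by (intro mult_right_mono) auto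
    then show False using * \<open>s \<ge> 2\<close> by (simp add: algebra_simps)
  qed
  then have "real (size \<B>) \<le> real l + 1" by linarith
  also have "real l + 1 \<le> DB v k l 1 (1 / (2 * real k))"
  proof -
    define K L S where "K = real k" and "L = real l" and "S = real_of_int s"
    have K: "3 \<le> K" using k_ge by (simp add: K_def)
    have LS: "L * S = K - 1"
      using arg_cong[OF ls, of real_of_int] by (simp add: K_def L_def S_def)
    have v: "real v = K + S" by (simp add: K_def S_def s_def)
    have "1 \<le> L" "2 \<le> S" using l_pos \<open>s \<ge> 2\<close> by (simp_all add: L_def S_def)
    then have "S \<le> K - 1" using LS mult_right_mono[of 1 L S] by simp
    have "K \<le> K * L" using K \<open>1 \<le> L\<close> by simp
    \<comment> \<open>The cross-multiplied form of
      \<open>L + 1 \<le> DB v k l 1 (1 / (2 * K))\<close>; substituting \<open>L * S = K - 1\<close>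
      removes the quadratic terms in \<open>K\<close>.\<close>
    have "real v * (2 * K * L - L - 1) - (L + 1) * (K * (2 * K - 3))
        = 2 * (K * L) - L * S - S + 2 * K * (L * S) - 2 * K * K + 2 * K"
      by (simp add: v algebra_simps)
    also have "\<dots> = 2 * (K * L) - K - S + 1" by (simp add: LS algebra_simps)
    also have "\<dots> \<ge> 0" using \<open>K \<le> K * L\<close> \<open>S \<le> K - 1\<close> K by linarith
    finally have "(L + 1) * (K * (2 * K - 3)) \<le> real v * (2 * K * L - L - 1)" by simp
    moreover have "DB v k l 1 (1 / (2 * real k)) = real v * (2 * K * L - L - 1) / (K * (2 * K - 3))"
      unfolding DB_def Let_def floor_replication r
      using K by (fold K_def) (simp add: L_def divide_simps, simp add: algebra_simps)
    moreover have "0 < K * (2 * K - 3)" using K by simp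
    ultimately show ?thesis by (simp add: L_def pos_le_divide_eq)
  qed
  finally show ?thesis .
qed

end

theorem theorem6p3:
  fixes v k l :: nat and r d n :: int
  assumes "0 < l" and "3 \<le> k" and "k < v"
    and "int l * (int v - 1) = r * (int k - 1) + d" and "0 \<le> d" and "d < int k - 1"
    and "n = r - int l" and "r < int k"
    and "d < n"
  shows
   "int (packing_number l v k) \<le>
      \<lfloor>DB v k l (1 - real_of_int d ^ 2 / (2 * real_of_int n * (real_of_int n - 1)))
                (real_of_int n / (2 * (real_of_int d + real k)))\<rfloor> \<and>
    (real_of_int d \<ge> real_of_int n / 2 \<and> d * (d + int k - 1) < n * (n - 1) \<longrightarrow>
      int (packing_number l v k) \<le>
        \<lfloor>DB v k l 1 (1 - real_of_int d * (real_of_int d + real k - 1)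
                          / (real_of_int n * (real_of_int n - 1)))\<rfloor>) \<and>
    (real_of_int d < real_of_int n / 2 \<and> 4 * n * (n - 1) * (n - d) > d * (d + int k) ^ 2 \<longrightarrow>
      int (packing_number l v k) \<le>
        \<lfloor>DB v k l 1 (sqrt (real_of_int d * real_of_int n
                            / ((real_of_int n - 1) * (real_of_int n - real_of_int d)))
                     - real_of_int d * (real_of_int d + real k)
                         / (2 * (real_of_int n - 1) * (real_of_int n - real_of_int d)))\<rfloor>)"
proof -
  obtain V :: "nat set" and \<B> where P: "packing v k l V \<B>" and size: "size \<B> = packing_number l v k"
    using packing_number_attained[of k] assms(2) by force
  interpret dense_packing v k l V \<B> r d n
    using P assms by unfold_locales
  have floor: "int (packing_number l v k) \<le> \<lfloor>x\<rfloor> \<longleftrightarrow> real (size \<B>) \<le> x" for x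
    by (simp add: size le_floor_iff)
  show ?thesis
    unfolding floor
  proof (intro conjI impI)
    show "real (size \<B>) \<le> DB v k l (1 - real_of_int d ^ 2 / (2 * real_of_int n * (real_of_int n - 1)))
                (real_of_int n / (2 * (real_of_int d + real k)))"
    proof (cases "n = 1")
      case True
      \<comment> \<open>The subtracted fraction in the first argument of \<open>DB\<close> is then
        \<open>0 / 0\<close>, which is \<open>0\<close> by convention, so that argument is
        1.\<close>
      then have "d = 0" using assms by simp
      then show ?thesis using bound_a_one True by simp
    next
      case False
      then show ?thesis using bound_a assms by simp
    qed
  next
    assume c: "real_of_int d < real_of_int n / 2 \<and> 4 * n * (n - 1) * (n - d) > d * (d + int k) ^ 2"
    \<comment> \<open>For \<open>n = 1\<close> the left side of the strict inequality in
      \<open>c\<close> would be 0.\<close>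
    have "0 \<le> d * (d + int k) ^ 2" using assms(5) by simp
    then have "n \<noteq> 1" using c by auto
    then show "real (size \<B>) \<le> DB v k l 1 (sqrt (real_of_int d * real_of_int n
                            / ((real_of_int n - 1) * (real_of_int n - real_of_int d)))
                     - real_of_int d * (real_of_int d + real k)
                         / (2 * (real_of_int n - 1) * (real_of_int n - real_of_int d)))"
      using bound_c c assms by simp
  qed (use bound_b in simp)
qed

end
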